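(* Let $0<q<1$, $n\in\mathbb N_0$, $\alpha,\beta\in(0,q^{-1})$, and $t\in\mathbb C$ with $|t|<\min\{(1-\beta^2)(1+\sqrt q|\beta|),1\}$. Then $$\sum_{k=0}^\infty\frac{(q\beta)^k}{(tq^k;q)_\infty}\;{}_0\phi_1\!\left(-;q\alpha;q,t\alpha q^{k+1}\right)\frac{p_n(q^k;\beta|q)}{(q;q)_k}=\frac{q^{\binom n2}(-q\beta t)^n}{(t,q\beta;q)_\infty(q\alpha;q)_n}\;{}_1\phi_1\!\left(\alpha/\beta;\alpha q^{n+1};q,t\beta q^{n+1}\right).$$
   Context: Notation: $(a;q)_0=1$, $(a;q)_n=\prod_{j=0}^{n-1}(1-aq^j)$, $(a;q)_\infty=\prod_{j\ge0}(1-aq^j)$, $(a_1,\dots,a_r;q)_n=\prod_i(a_i;q)_n$ (also for $n=\infty$). The basic hypergeometric series, with upper parameters listed before the first semicolon and lower parameters before the second (a dash denotes an empty list), is $${}_r\phi_s(a_1,\dots,a_r;b_1,\dots,b_s;q,z)=\sum_{k=0}^\infty\frac{(a_1,\dots,a_r;q)_k}{(q,b_1,\dots,b_s;q)_k}\left((-1)^kq^{\binom k2}\right)^{1+s-r}z^k.$$ The little $q$-Laguerre/Wall polynomials are $$p_n(x;a|q)={}_2\phi_1\!\left(q^{-n},0;aq;q,qx\right).$$ *)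

theory Defs
  imports "HOL-Analysis.Analysis"
begin

definition qpoch :: "'a::real_normed_field \<Rightarrow> 'a \<Rightarrow> nat \<Rightarrow> 'a" where
  "qpoch a q n = (\<Prod>j<n. 1 - a * q ^ j)"

definition qpoch_inf :: "'a::real_normed_field \<Rightarrow> 'a \<Rightarrow> 'a" where
  "qpoch_inf a q = (\<Prod>j. 1 - a * q ^ j)"

definition qpochs :: "'a::real_normed_field list \<Rightarrow> 'a \<Rightarrow> nat \<Rightarrow> 'a" where
  "qpochs as q n = (\<Prod>a\<leftarrow>as. qpoch a q n)"

definition qpochs_inf :: "'a::real_normed_field list \<Rightarrow> 'a \<Rightarrow> 'a" where
  "qpochs_inf as q = (\<Prod>a\<leftarrow>as. qpoch_inf a q)"

text \<open>
  The basic hypergeometric series with upper parameters \<open>as\<close> and lower parameters \<open>bs\<close>.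
  The exponent \<open>1 + s - r\<close> is an integer that may be negative, hence \<open>powi\<close>.
\<close>
definition basic_hypergeom ::
    "'a::real_normed_field list \<Rightarrow> 'a list \<Rightarrow> 'a \<Rightarrow> 'a \<Rightarrow> 'a" where
  "basic_hypergeom as bs q z =
     (\<Sum>k. qpochs as q k / qpochs (q # bs) q k
          * ((-1) ^ k * q ^ (k choose 2)) powi (1 + int (length bs) - int (length as))
          * z ^ k)"

definition little_q_Laguerre :: "nat \<Rightarrow> 'a::real_normed_field \<Rightarrow> 'a \<Rightarrow> 'a \<Rightarrow> 'a" where
  "little_q_Laguerre n x a q = basic_hypergeom [q powi (- int n), 0] [a * q] q (q * x)"

end

theory Submission
  imports Defs
begin

text \<open>
  Write \<open>c = q\<beta>\<close>, and let \<open>L\<close> be the functional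
  \<open>L(f) = \<Sum>k. c^k / (q;q)_k * f(q^k)\<close>, the orthogonality functional of the
  polynomials \<open>p_n(x;\<beta>|q)\<close>. The left-hand side is \<open>L(F p_n)\<close>, where
  \<open>F(x) = 1/(tx;q)_\<infinity> * 0\<phi>1(-; q\<alpha>; q, t\<alpha>qx)\<close>. The point is that \<open>F\<close> has an
  extremely simple power series,
  \<open>F(x) = \<Sum>i. (tx)^i / ((q;q)_i (q\<alpha>;q)_i)\<close>, so that only the moments \<open>L(x^i p_n)\<close>
  are needed.

  By Euler's expansion of \<open>1/(z;q)_\<infinity>\<close>, \<open>L(x^j) = (c;q)_j / (c;q)_\<infinity>\<close>. Hence
  \<open>L(x^i p_n)\<close> is a terminating \<open>2\<phi>1\<close> with argument \<open>q\<close>, which the \<open>q\<close>-Chu--Vandermonde sum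
  evaluates to a multiple of \<open>\<Prod>j<n. q^i - q^j\<close>
  (lemma \<open>little_q_Laguerre_moment\<close>). It vanishes for \<open>i < n\<close>, which is orthogonality and
  produces the factor \<open>t^n\<close>. The terms \<open>i = n + m\<close> give a multiple of
  \<open>\<Sum>m. (b;q)_m t^m / ((C;q)_m (q;q)_m)\<close> with \<open>b = \<beta>q^(n+1)\<close> and \<open>C = \<alpha>q^(n+1)\<close>.

  Both the expansion of \<open>F\<close> and the passage from this last series to the \<open>1\<phi>1\<close> of the
  right-hand side are instances of one transformation (lemma \<open>confluent_transformation\<close>),
  with \<open>b = 0\<close> and \<open>b = \<beta>q^(n+1)\<close> respectively. That transformation compares coefficients in a
  Cauchy product, and the coefficients agree by the other \<open>q\<close>-Chu--Vandermonde sum.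
  Absolute convergence of the double series over \<open>k\<close> and \<open>i\<close> justifies applying \<open>L\<close> to \<open>F p_n\<close>
  term by term.
\<close>

section \<open>Finite shifted factorials\<close>

lemma qpoch_0 [simp]: "qpoch a q 0 = 1"
  by (simp add: qpoch_def)

lemma qpoch_Suc: "qpoch a q (Suc n) = qpoch a q n * (1 - a * q ^ n)"
  by (simp add: qpoch_def)

lemma qpoch_add: "qpoch a q (m + n) = qpoch a q m * qpoch (a * q ^ m) q n"
  by (induction n) (simp_all add: qpoch_Suc power_add mult_ac)

lemma qpoch_Suc_left: "qpoch a q (Suc n) = (1 - a) * qpoch (a * q) q n"
  using qpoch_add[of a q 1 n] by (simp add: qpoch_Suc)

lemma power_neq_1:
  fixes q :: "'a::real_normed_field"
  assumes "norm q < 1" "n > 0"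
  shows "q ^ n \<noteq> 1"
proof
  assume "q ^ n = 1"
  hence "norm q ^ n = 1" by (metis norm_one norm_power)
  moreover have "norm q ^ n < 1"
    using assms by (simp add: power_less_one_iff)
  ultimately show False by simp
qed

lemma mult_power_norm_less_1:
  fixes a q :: "'a::real_normed_field"
  assumes "norm q < 1" "norm a < 1"
  shows "norm (a * q ^ n) < 1"
proof -
  have "norm q ^ n \<le> 1"
    using assms by (simp add: power_le_one)
  hence "norm a * norm q ^ n \<le> norm a"
    by (simp add: mult_left_le)
  with assms show ?thesis by (simp add: norm_mult norm_power)
qed

lemma qpoch_nonzero:
  fixes a q :: "'a::real_normed_field"
  assumes "\<And>j. a * q ^ j \<noteq> 1"
  shows "qpoch a q n \<noteq> 0"
  using assms by (simp add: qpoch_def)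

lemma qpoch_nonzero':
  fixes a q :: "'a::real_normed_field"
  assumes "norm q < 1" "norm a < 1"
  shows "qpoch a q n \<noteq> 0"
  using mult_power_norm_less_1[OF assms] by (intro qpoch_nonzero) (metis norm_one less_irrefl)

lemma qpoch_self_Suc: "qpoch q q (Suc n) = qpoch q q n * (1 - q ^ Suc n)"
  by (simp add: qpoch_Suc)

lemma choose_two_Suc: "Suc n choose 2 = (n choose 2) + n"
  by (simp add: numeral_2_eq_2)

lemma prod_power_choose_two:
  fixes q :: "'a::comm_monoid_mult"
  shows "(\<Prod>j<n. q ^ j) = q ^ (n choose 2)"
  by (induction n) (simp_all add: choose_two_Suc power_add binomial_eq_0)

section \<open>Gaussian binomial coefficients\<close>

definition qbinom :: "'a::real_normed_field \<Rightarrow> nat \<Rightarrow> nat \<Rightarrow> 'a" where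
  "qbinom q m s = (if s \<le> m then qpoch q q m / (qpoch q q s * qpoch q q (m - s)) else 0)"

lemma qbinom_0 [simp]:
  fixes q :: "'a::real_normed_field"
  assumes "norm q < 1"
  shows "qbinom q m 0 = 1"
  using qpoch_nonzero'[OF assms assms] by (simp add: qbinom_def)

lemma qbinom_gt [simp]: "m < s \<Longrightarrow> qbinom q m s = 0"
  by (simp add: qbinom_def)

text \<open>
  The two rules are exchanged by \<open>s \<mapsto> m - s\<close>. Each of the Chu--Vandermonde sums below needs the
  one whose power of \<open>q\<close> combines with its summand.
\<close>

lemma qbinom_pascal:
  fixes q :: "'a::real_normed_field"
  assumes q: "norm q < 1" and "s \<le> m"
  shows "qbinom q (Suc m) (Suc s) = qbinom q m (Suc s) + q ^ (m - s) * qbinom q m s"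
    and "qbinom q (Suc m) (Suc s) = q ^ Suc s * qbinom q m (Suc s) + qbinom q m s"
proof -
  note nz = qpoch_nonzero'[OF q q]
  have "qbinom q (Suc m) (Suc s) = qbinom q m (Suc s) + q ^ (m - s) * qbinom q m s \<and>
        qbinom q (Suc m) (Suc s) = q ^ Suc s * qbinom q m (Suc s) + qbinom q m s"
  proof (cases "s = m")
    case True
    thus ?thesis using nz[of m] nz[of "Suc m"] by (simp add: qbinom_def)
  next
    case False
    with assms obtain r where m: "m = s + Suc r"
      by (metis add_Suc_right le_neq_implies_less less_imp_Suc_add)
    define X where "X = qpoch q q m / (qpoch q q s * qpoch q q r)"
    define u v where "u = q ^ Suc s" and "v = q ^ Suc r"
    have nz': "1 - u \<noteq> 0" "1 - v \<noteq> 0"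
      using power_neq_1[OF q, of "Suc s"] power_neq_1[OF q, of "Suc r"] by (auto simp: u_def v_def)
    have uv: "q ^ Suc m = u * v"
      by (simp add: u_def v_def m power_add mult_ac)
    have 1: "qbinom q (Suc m) (Suc s) = X * (1 - u * v) / ((1 - u) * (1 - v))"
      using nz unfolding uv[symmetric]
      by (simp add: qbinom_def m X_def qpoch_self_Suc u_def v_def)
    have 2: "qbinom q m (Suc s) = X / (1 - u)"
      using nz by (simp add: qbinom_def m X_def qpoch_self_Suc u_def)
    have 3: "qbinom q m s = X / (1 - v)"
      using nz by (simp add: qbinom_def m X_def qpoch_self_Suc v_def)
    have 4: "q ^ (m - s) = v" "q ^ Suc s = u" by (simp_all add: m v_def u_def)
    show ?thesis unfolding 1 2 3 4 using nz' by (simp add: divide_simps) (simp add: algebra_simps)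
  qed
  thus "qbinom q (Suc m) (Suc s) = qbinom q m (Suc s) + q ^ (m - s) * qbinom q m s"
    and "qbinom q (Suc m) (Suc s) = q ^ Suc s * qbinom q m (Suc s) + qbinom q m s"
    by blast+
qed

text \<open>
  Pascal's rules in the form used in an induction on \<open>m\<close>: the terms \<open>s = 0\<close> and \<open>s = m + 1\<close> are
  absorbed because the coefficients vanish outside \<open>{0..m}\<close>.
\<close>

lemma sum_qbinom_Suc:
  fixes q :: "'a::real_normed_field"
  assumes q: "norm q < 1"
  shows "(\<Sum>s\<le>Suc m. qbinom q (Suc m) s * g s) =
           (\<Sum>s\<le>m. qbinom q m s * g s) + (\<Sum>s\<le>m. q ^ (m - s) * qbinom q m s * g (Suc s))"
    and "(\<Sum>s\<le>Suc m. qbinom q (Suc m) s * g s) =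
           (\<Sum>s\<le>m. q ^ s * qbinom q m s * g s) + (\<Sum>s\<le>m. qbinom q m s * g (Suc s))"
proof -
  have shift: "h 0 + (\<Sum>s\<le>m. h (Suc s)) = (\<Sum>s\<le>m. h s)" if "h (Suc m) = 0" for h :: "nat \<Rightarrow> 'a"
    using sum.atMost_Suc_shift[of h m] that by simp
  have "(\<Sum>s\<le>Suc m. qbinom q (Suc m) s * g s) =
          g 0 + (\<Sum>s\<le>m. qbinom q m (Suc s) * g (Suc s) + q ^ (m - s) * qbinom q m s * g (Suc s))"
    by (subst sum.atMost_Suc_shift) (simp add: q qbinom_pascal(1) algebra_simps)
  also have "\<dots> = (\<Sum>s\<le>m. qbinom q m s * g s) + (\<Sum>s\<le>m. q ^ (m - s) * qbinom q m s * g (Suc s))"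
    using shift[of "\<lambda>s. qbinom q m s * g s"] q by (simp add: sum.distrib add_ac)
  finally show "(\<Sum>s\<le>Suc m. qbinom q (Suc m) s * g s) =
           (\<Sum>s\<le>m. qbinom q m s * g s) + (\<Sum>s\<le>m. q ^ (m - s) * qbinom q m s * g (Suc s))" .
  have "(\<Sum>s\<le>Suc m. qbinom q (Suc m) s * g s) =
          g 0 + (\<Sum>s\<le>m. q ^ Suc s * qbinom q m (Suc s) * g (Suc s) + qbinom q m s * g (Suc s))"
    by (subst sum.atMost_Suc_shift) (simp add: q qbinom_pascal(2) algebra_simps)
  also have "\<dots> = (\<Sum>s\<le>m. q ^ s * qbinom q m s * g s) + (\<Sum>s\<le>m. qbinom q m s * g (Suc s))"
    using shift[of "\<lambda>s. q ^ s * qbinom q m s * g s"] q by (simp add: sum.distrib add_ac)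
  finally show "(\<Sum>s\<le>Suc m. qbinom q (Suc m) s * g s) =
           (\<Sum>s\<le>m. q ^ s * qbinom q m s * g s) + (\<Sum>s\<le>m. qbinom q m s * g (Suc s))" .
qed

section \<open>The two Chu--Vandermonde sums\<close>

text \<open>
  For \<open>b \<noteq> 0\<close> the product in the summand is \<open>(C/b;q)_s (-b)^s q^(s choose 2)\<close>, and division by
  \<open>(C;q)_m\<close> gives the sum of \<open>2\<phi>1(q^-m, C/b; C; q, bq^m)\<close>. The form without denominators also
  covers the limit \<open>b = 0\<close>, a finite form of Cauchy's identity.

  Pascal's rule splits the sum for \<open>m + 1\<close> into the sums for \<open>m\<close> with parameters \<open>C\<close> and \<open>Cq\<close>.
  Both equal \<open>(b;q)_m\<close>, with coefficients \<open>1 - Cq^m\<close> and \<open>(C - b)q^m\<close> that add up to \<open>1 - bq^m\<close>.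
\<close>

lemma chu_vandermonde_confluent:
  fixes q b C :: "'a::real_normed_field"
  assumes q: "norm q < 1"
  shows "(\<Sum>s\<le>m. qbinom q m s * ((\<Prod>j<s. (C * q ^ j - b) * q ^ j) * qpoch (C * q ^ s) q (m - s)))
           = qpoch b q m"
proof (induction m arbitrary: C)
  case 0
  show ?case by (simp add: q)
next
  case (Suc m)
  define P where "P = (\<lambda>C s. \<Prod>j<s. (C * q ^ j - b) * q ^ j)"
  have P_Suc: "P C (Suc s) = (C - b) * q ^ s * P (C * q) s" for s
  proof -
    have "P C (Suc s) = (C - b) * (\<Prod>j<s. q * ((C * q * q ^ j - b) * q ^ j))"
      unfolding P_def by (subst prod.lessThan_Suc_shift) (simp add: mult_ac)
    also have "\<dots> = (C - b) * q ^ s * P (C * q) s"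
      unfolding P_def by (subst prod.distrib) simp
    finally show ?thesis .
  qed
  have IH: "(\<Sum>s\<le>m. qbinom q m s * (P C s * qpoch (C * q ^ s) q (m - s))) = qpoch b q m" for C
    using Suc.IH unfolding P_def .
  have 1: "(\<Sum>s\<le>m. qbinom q m s * (P C s * qpoch (C * q ^ s) q (Suc m - s)))
          = (1 - C * q ^ m) * qpoch b q m"
    unfolding IH[of C, symmetric] sum_distrib_left
  proof (rule sum.cong)
    fix s assume "s \<in> {..m}"
    then obtain r where r: "m = s + r" by (auto simp: le_iff_add)
    show "qbinom q m s * (P C s * qpoch (C * q ^ s) q (Suc m - s)) =
          (1 - C * q ^ m) * (qbinom q m s * (P C s * qpoch (C * q ^ s) q (m - s)))"
      by (simp add: r Suc_diff_le qpoch_Suc power_add mult_ac)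
  qed simp
  have 2: "(\<Sum>s\<le>m. q ^ (m - s) * qbinom q m s * (P C (Suc s) * qpoch (C * q ^ Suc s) q (Suc m - Suc s)))
          = (C - b) * q ^ m * qpoch b q m"
    unfolding IH[of "C * q", symmetric] sum_distrib_left
  proof (rule sum.cong)
    fix s assume "s \<in> {..m}"
    then obtain r where r: "m = s + r" by (auto simp: le_iff_add)
    show "q ^ (m - s) * qbinom q m s * (P C (Suc s) * qpoch (C * q ^ Suc s) q (Suc m - Suc s)) =
          (C - b) * q ^ m * (qbinom q m s * (P (C * q) s * qpoch (C * q * q ^ s) q (m - s)))"
      by (simp add: r P_Suc power_add mult_ac)
  qed simp
  have "(\<Sum>s\<le>Suc m. qbinom q (Suc m) s * (P C s * qpoch (C * q ^ s) q (Suc m - s)))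
          = (1 - C * q ^ m) * qpoch b q m + (C - b) * q ^ m * qpoch b q m"
    unfolding sum_qbinom_Suc(1)[OF q] 1 2 ..
  thus ?case
    unfolding P_def by (simp add: qpoch_Suc algebra_simps)
qed

text \<open>
  The sum of \<open>2\<phi>1(q^-n, b; c; q, q)\<close>, multiplied by \<open>q^(n choose 2) (c;q)_n\<close> to remove denominators
  and negative powers of \<open>q\<close>. Pascal's rule reduces \<open>n + 1\<close> to \<open>n\<close> with parameters \<open>(b, c)\<close> and
  \<open>(bq, cq)\<close>; the right-hand side is homogeneous in \<open>(b, c)\<close>, so the two values
  differ by the factor \<open>q^n\<close> only.
\<close>

lemma chu_vandermonde_terminating:
  fixes q b c :: "'a::real_normed_field"
  assumes q: "norm q < 1"
  shows "(\<Sum>l\<le>n. qbinom q n l * ((-1) ^ l * q ^ ((n - l) choose 2) * qpoch b q l * qpoch (c * q ^ l) q (n - l)))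
           = q ^ (n choose 2) * (\<Prod>j<n. b - c * q ^ j)"
proof (induction n arbitrary: b c)
  case 0
  show ?case by (simp add: q)
next
  case (Suc n)
  let ?g = "\<lambda>n b c l. (-1) ^ l * q ^ ((n - l) choose 2) * qpoch b q l * qpoch (c * q ^ l) q (n - l)"
  let ?R = "\<lambda>b c. q ^ (n choose 2) * (\<Prod>j<n. b - c * q ^ j)"
  have 1: "(\<Sum>l\<le>n. q ^ l * qbinom q n l * ?g (Suc n) b c l) = q ^ n * (1 - c * q ^ n) * ?R b c"
    unfolding Suc.IH[of b c, symmetric] sum_distrib_left
  proof (rule sum.cong)
    fix l assume "l \<in> {..n}"
    then obtain r where r: "n = l + r" by (auto simp: le_iff_add)
    show "q ^ l * qbinom q n l * ?g (Suc n) b c l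
           = q ^ n * (1 - c * q ^ n) * (qbinom q n l * ?g n b c l)"
      by (simp add: r Suc_diff_le qpoch_Suc choose_two_Suc power_add mult_ac)
  qed simp
  have 2: "(\<Sum>l\<le>n. qbinom q n l * ?g (Suc n) b c (Suc l)) = - (1 - b) * ?R (b * q) (c * q)"
    unfolding Suc.IH[of "b * q" "c * q", symmetric] sum_distrib_left
    by (rule sum.cong) (simp_all add: qpoch_Suc_left algebra_simps)
  have 3: "?R (b * q) (c * q) = q ^ n * ?R b c"
  proof -
    have "(\<Prod>j<n. b * q - c * q * q ^ j) = (\<Prod>j<n. q * (b - c * q ^ j))"
      by (simp add: algebra_simps)
    also have "\<dots> = q ^ n * (\<Prod>j<n. b - c * q ^ j)"
      by (subst prod.distrib) simp
    finally show ?thesis by simp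
  qed
  show ?case
    unfolding sum_qbinom_Suc(2)[OF q] 1 2 3
    by (simp add: choose_two_Suc power_add algebra_simps)
qed

section \<open>Convergence and Euler's expansion\<close>

lemma tendsto_mult_power_0:
  fixes q :: "'a::real_normed_field"
  assumes "norm q < 1"
  shows "(\<lambda>n. a * q ^ n) \<longlonglongrightarrow> 0"
  using tendsto_mult_right_zero[OF LIMSEQ_power_zero[OF assms]] by simp

text \<open>
  Basic hypergeometric terms have convergent ratios, so this form of d'Alembert's test applies to
  them. The ratio is given as a separate function \<open>r\<close> to permit vanishing terms.
\<close>

lemma summable_norm_ratio_tendsto:
  fixes f :: "nat \<Rightarrow> 'a::real_normed_field"
  assumes "\<And>n. f (Suc n) = r n * f n" "r \<longlonglongrightarrow> L" "norm L < 1"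
  shows "summable (\<lambda>n. norm (f n))"
proof -
  obtain c where c: "norm L < c" "c < 1" using assms(3) dense by blast
  have "eventually (\<lambda>n. norm (r n) < c) sequentially"
    using tendsto_norm[OF assms(2)] c(1) by (rule order_tendstoD)
  then obtain N where N: "\<And>n. n \<ge> N \<Longrightarrow> norm (r n) < c"
    by (auto simp: eventually_at_top_linorder)
  show ?thesis
  proof (rule summable_ratio_test[OF c(2), of N])
    fix n assume "n \<ge> N"
    from N[OF this] show "norm (norm (f (Suc n))) \<le> c * norm (norm (f n))"
      by (simp add: assms(1) norm_mult mult_right_mono)
  qed
qed

lemma summable_norm_qpoch_quotient:
  fixes q b C z :: "'a::real_normed_field"
  assumes q: "norm q < 1" and z: "norm z < 1"
  shows "summable (\<lambda>m. norm (qpoch b q m * z ^ m / (qpoch C q m * qpoch q q m)))"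
proof (rule summable_norm_ratio_tendsto)
  show "(\<lambda>m. (1 - b * q ^ m) * z / ((1 - C * q ^ m) * (1 - q * q ^ m))) \<longlonglongrightarrow> (1 - 0) * z / ((1 - 0) * (1 - 0))"
    using tendsto_mult_power_0[OF q]
    by (intro tendsto_intros) auto
qed (use z in \<open>simp_all add: qpoch_Suc mult_ac\<close>)

lemma summable_norm_powser_qpoch:
  fixes q z :: "'a::real_normed_field"
  assumes q: "norm q < 1" and z: "norm z < 1"
  shows "summable (\<lambda>m. norm (z ^ m / qpoch q q m))"
  using summable_norm_qpoch_quotient[OF assms, of 0 0] by (simp add: qpoch_def)

lemma summable_norm_confluent:
  fixes q b C z :: "'a::real_normed_field"
  assumes q: "norm q < 1"
  shows "summable (\<lambda>s. norm ((\<Prod>j<s. (C * q ^ j - b) * q ^ j) * z ^ s / (qpoch C q s * qpoch q q s)))"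
proof (rule summable_norm_ratio_tendsto)
  show "(\<lambda>s. (C * q ^ s - b) * q ^ s * z / ((1 - C * q ^ s) * (1 - q * q ^ s)))
           \<longlonglongrightarrow> (0 - b) * 0 * z / ((1 - 0) * (1 - 0))"
    using q tendsto_mult_power_0[OF q]
    by (intro tendsto_intros) auto
qed (simp_all add: qpoch_Suc mult_ac)

lemma qpoch_tendsto_qpoch_inf:
  fixes q a :: "'a::{real_normed_field,banach}"
  assumes q: "norm q < 1"
  shows "qpoch a q \<longlonglongrightarrow> qpoch_inf a q"
proof -
  have "summable (\<lambda>i. norm a * norm q ^ i)"
    using q by (intro summable_mult summable_geometric) simp
  hence "summable (\<lambda>i. norm ((1 - a * q ^ i) - 1))"
    by (simp add: norm_mult norm_power)
  hence "convergent_prod (\<lambda>i. 1 - a * q ^ i)"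
    by (intro abs_convergent_prod_imp_convergent_prod summable_imp_abs_convergent_prod)
  from convergent_prod_LIMSEQ[OF this] show ?thesis
    by (simp add: qpoch_inf_def qpoch_def[abs_def] flip: LIMSEQ_lessThan_iff_atMost)
qed

text \<open>
  The series \<open>G\<close> satisfies \<open>(1 - z) G(z) = G(qz)\<close>, as one sees by comparing coefficients.
  Iterating, \<open>(z;q)_N G(z) = G(q^N z)\<close>, which tends to \<open>G(0) = 1\<close> by continuity.
\<close>

lemma euler_qpoch_inf:
  fixes q z :: "'a::{real_normed_field,banach}"
  assumes q: "norm q < 1" and z: "norm z < 1"
  shows "(\<Sum>m. z ^ m / qpoch q q m) * qpoch_inf z q = 1"
proof -
  define G where "G = (\<lambda>z. \<Sum>m. z ^ m / qpoch q q m)"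
  have summ: "summable (\<lambda>m. z ^ m / qpoch q q m)" if "norm z < 1" for z
    using summable_norm_powser_qpoch[OF q that] by (rule summable_norm_cancel)
  have G_step: "G w * (1 - w) = G (w * q)" if w: "norm w < 1" for w
  proof -
    let ?f = "\<lambda>m. w ^ m / qpoch q q m"
    have wq: "norm (w * q) < 1" using mult_power_norm_less_1[OF q w, of 1] by simp
    have "(\<lambda>m. ?f m - (w * q) ^ m / qpoch q q m) sums (G w - G (w * q))"
      unfolding G_def by (intro sums_diff summable_sums summ w wq)
    hence "(\<lambda>m. ?f (Suc m) - (w * q) ^ Suc m / qpoch q q (Suc m)) sums (G w - G (w * q))"
      by (subst sums_Suc_iff) simp
    also have "(\<lambda>m. ?f (Suc m) - (w * q) ^ Suc m / qpoch q q (Suc m)) = (\<lambda>m. w * ?f m)"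
    proof
      fix m
      have "1 - q ^ Suc m \<noteq> 0" using power_neq_1[OF q, of "Suc m"] by simp
      thus "?f (Suc m) - (w * q) ^ Suc m / qpoch q q (Suc m) = w * ?f m"
        using qpoch_nonzero'[OF q q, of m]
        by (simp add: qpoch_self_Suc power_mult_distrib divide_simps) (simp add: algebra_simps)
    qed
    finally have "G w - G (w * q) = w * G w"
      unfolding G_def using sums_mult[OF summable_sums[OF summ[OF w]], of w] sums_unique2 by blast
    thus ?thesis by (simp add: algebra_simps)
  qed
  have G_iter: "G z * qpoch z q N = G (z * q ^ N)" for N
  proof (induction N)
    case (Suc N)
    have "G z * qpoch z q (Suc N) = G (z * q ^ N) * (1 - z * q ^ N)"
      using Suc by (simp add: qpoch_Suc flip: mult.assoc)
    also have "\<dots> = G (z * q ^ Suc N)"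
      using G_step[OF mult_power_norm_less_1[OF q z]] by (simp add: mult_ac)
    finally show ?case .
  qed simp
  have "isCont G 0"
  proof -
    obtain r where r: "0 < r" "r < (1::real)" using dense[of 0 "1::real"] by auto
    have "summable (\<lambda>m. (1 / qpoch q q m) * (of_real r :: 'a) ^ m)"
      using summ[of "of_real r"] r by simp
    hence "isCont (\<lambda>z. \<Sum>m. (1 / qpoch q q m) * z ^ m) 0"
      using r by (intro isCont_powser) auto
    thus ?thesis by (simp add: G_def)
  qed
  hence "(\<lambda>N. G (z * q ^ N)) \<longlonglongrightarrow> G 0"
    using tendsto_mult_power_0[OF q] by (rule isCont_tendsto_compose)
  moreover have "G 0 = 1"
    using powser_zero[of "\<lambda>m. 1 / qpoch q q m"] by (simp add: G_def)
  moreover have "(\<lambda>N. G z * qpoch z q N) \<longlonglongrightarrow> G z * qpoch_inf z q"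
    by (intro tendsto_intros qpoch_tendsto_qpoch_inf q)
  ultimately show ?thesis
    unfolding G_iter using LIMSEQ_unique by (fastforce simp: G_def)
qed

lemma qpoch_inf_nonzero:
  fixes q z :: "'a::{real_normed_field,banach}"
  assumes "norm q < 1" "norm z < 1"
  shows "qpoch_inf z q \<noteq> 0"
  using euler_qpoch_inf[OF assms] by auto

lemma euler_sums:
  fixes q z :: "'a::{real_normed_field,banach}"
  assumes "norm q < 1" "norm z < 1"
  shows "(\<lambda>m. z ^ m / qpoch q q m) sums (1 / qpoch_inf z q)"
proof -
  have "(\<Sum>m. z ^ m / qpoch q q m) = 1 / qpoch_inf z q"
    using euler_qpoch_inf[OF assms] qpoch_inf_nonzero[OF assms] by (simp add: eq_divide_eq)
  thus ?thesis
    using summable_sums[OF summable_norm_cancel[OF summable_norm_powser_qpoch[OF assms]]] by simp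
qed

lemma qpoch_inf_split:
  fixes q z :: "'a::{real_normed_field,banach}"
  assumes q: "norm q < 1"
  shows "qpoch_inf z q = qpoch z q n * qpoch_inf (z * q ^ n) q"
proof -
  have "(\<lambda>m. qpoch z q (m + n)) \<longlonglongrightarrow> qpoch_inf z q"
    using qpoch_tendsto_qpoch_inf[OF q] by (rule LIMSEQ_ignore_initial_segment)
  moreover have "(\<lambda>m. qpoch z q (m + n)) \<longlonglongrightarrow> qpoch z q n * qpoch_inf (z * q ^ n) q"
    unfolding add.commute[of _ n] qpoch_add
    by (intro tendsto_intros qpoch_tendsto_qpoch_inf q)
  ultimately show ?thesis by (rule LIMSEQ_unique)
qed

section \<open>A transformation to a confluent series\<close>

text \<open>
  The right-hand side is the Cauchy product of Euler's series for \<open>1/(z;q)_\<infinity>\<close> with a series of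
  confluent type; lemma \<open>chu_vandermonde_confluent\<close> evaluates the coefficient of \<open>z^m\<close>. The
  confluent series is a \<open>0\<phi>1\<close> for \<open>b = 0\<close> and a \<open>1\<phi>1\<close> otherwise.
\<close>

lemma confluent_transformation:
  fixes q b C z :: "'a::{real_normed_field,banach}"
  assumes q: "norm q < 1" and z: "norm z < 1" and C: "\<And>j. C * q ^ j \<noteq> 1"
  shows "(\<lambda>m. qpoch b q m * z ^ m / (qpoch C q m * qpoch q q m)) sums
           (1 / qpoch_inf z q *
             (\<Sum>s. (\<Prod>j<s. (C * q ^ j - b) * q ^ j) * z ^ s / (qpoch C q s * qpoch q q s)))"
proof -
  let ?P = "\<lambda>s. \<Prod>j<s. (C * q ^ j - b) * q ^ j"
  let ?e = "\<lambda>m. z ^ m / qpoch q q m" and ?f = "\<lambda>s. ?P s * z ^ s / (qpoch C q s * qpoch q q s)"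
  have "(\<lambda>m. \<Sum>s\<le>m. ?f s * ?e (m - s)) sums ((\<Sum>s. ?f s) * (\<Sum>m. ?e m))"
    by (intro Cauchy_product_sums summable_norm_confluent summable_norm_powser_qpoch q z)
  moreover have "(\<Sum>s\<le>m. ?f s * ?e (m - s)) = qpoch b q m * z ^ m / (qpoch C q m * qpoch q q m)" for m
  proof -
    have "(\<Sum>s\<le>m. ?f s * ?e (m - s)) = (\<Sum>s\<le>m. z ^ m / (qpoch C q m * qpoch q q m)
            * (qbinom q m s * (?P s * qpoch (C * q ^ s) q (m - s))))"
    proof (rule sum.cong)
      fix s assume "s \<in> {..m}"
      then obtain r where r: "m = s + r" by (auto simp: le_iff_add)
      have nz: "qpoch C q m \<noteq> 0" "qpoch q q m \<noteq> 0"
        using qpoch_nonzero[OF C] qpoch_nonzero'[OF q q] by auto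
      have "qpoch C q m = qpoch C q s * qpoch (C * q ^ s) q r"
        by (simp add: r qpoch_add)
      with nz show "?f s * ?e (m - s) = z ^ m / (qpoch C q m * qpoch q q m)
            * (qbinom q m s * (?P s * qpoch (C * q ^ s) q (m - s)))"
        by (simp add: r qbinom_def power_add mult_ac)
    qed simp
    also have "\<dots> = qpoch b q m * z ^ m / (qpoch C q m * qpoch q q m)"
      unfolding sum_distrib_left[symmetric] chu_vandermonde_confluent[OF q] by simp
    finally show ?thesis .
  qed
  ultimately show ?thesis
    using euler_sums[OF q z] by (simp add: sums_iff mult_ac)
qed

lemma basic_hypergeom_0_1_eq:
  fixes q C z :: "'a::real_normed_field"
  shows "basic_hypergeom [] [C] q (z * C) =
           (\<Sum>s. (\<Prod>j<s. (C * q ^ j - 0) * q ^ j) * z ^ s / (qpoch C q s * qpoch q q s))"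
proof -
  have "(\<Prod>j<s. (C * q ^ j) * q ^ j) = C ^ s * (q ^ (s choose 2))\<^sup>2" for s
    by (simp add: prod.distrib prod_power_choose_two power2_eq_square)
  moreover have "((-1) ^ s * q ^ (s choose 2)) powi 2 = (q ^ (s choose 2))\<^sup>2" for s
    by (cases "even s") simp_all
  ultimately show ?thesis
    by (simp add: basic_hypergeom_def qpochs_def power_mult_distrib[of C z] mult_ac)
qed

lemma basic_hypergeom_1_1_eq:
  fixes q b C z :: "'a::real_normed_field"
  assumes "b \<noteq> 0"
  shows "basic_hypergeom [C / b] [C] q (z * b) =
           (\<Sum>s. (\<Prod>j<s. (C * q ^ j - b) * q ^ j) * z ^ s / (qpoch C q s * qpoch q q s))"
proof -
  have "(\<Prod>j<s. (C * q ^ j - b) * q ^ j) = qpoch (C / b) q s * ((-1) ^ s * q ^ (s choose 2)) * b ^ s" for s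
  proof -
    have "(\<Prod>j<s. (C * q ^ j - b) * q ^ j) = (\<Prod>j<s. (1 - C / b * q ^ j) * ((-1) * q ^ j * b))"
      using assms by (intro prod.cong) (simp_all add: field_simps)
    thus ?thesis
      by (simp only: prod.distrib prod_power_choose_two prod_constant card_lessThan qpoch_def mult.assoc)
  qed
  thus ?thesis
    by (simp add: basic_hypergeom_def qpochs_def power_mult_distrib mult_ac)
qed

section \<open>Moments of the little q-Laguerre polynomials\<close>

lemma qpoch_neg_power_eq_0:
  fixes q :: "'a::real_normed_field"
  assumes "q \<noteq> 0" "n < l"
  shows "qpoch (q powi (- int n)) q l = 0"
  using assms by (auto simp: qpoch_def power_int_minus intro!: bexI[of _ n])

text \<open>
  This is \<open>(q^-n;q)_l / (q;q)_l = (-1)^l q^((l choose 2) - nl) [n choose l]_q\<close>, rearranged so that only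
  natural exponents occur, by \<open>(n - l choose 2) = (n choose 2) + (l choose 2) + l - nl\<close>.
\<close>

lemma qpoch_neg_power:
  fixes q :: "'a::real_normed_field"
  assumes "q \<noteq> 0" "l \<le> n"
  shows "qpoch (q powi (- int n)) q l * q ^ l * q ^ (n choose 2) * qpoch q q (n - l)
           = (-1) ^ l * q ^ ((n - l) choose 2) * qpoch q q n"
  using assms(2)
proof (induction l)
  case (Suc l)
  then obtain r where n: "n = Suc l + r" by (metis le_iff_add)
  have e: "1 - q powi (- int n) * q ^ l = - (1 - q ^ Suc r) / q ^ Suc r"
  proof -
    have "q powi (- int n) = inverse (q ^ n)"
      by (simp add: power_int_minus)
    also have "q ^ n = q ^ l * q ^ Suc r"
      by (simp add: n power_add)
    finally show ?thesis
      using assms(1) by (simp add: field_simps)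
  qed
  have IH: "qpoch (q powi (- int n)) q l * q ^ l * q ^ (n choose 2) * (qpoch q q r * (1 - q ^ Suc r))
              = (-1) ^ l * (q ^ (r choose 2) * q ^ r) * qpoch q q n"
    using Suc by (simp add: n choose_two_Suc power_add Suc_diff_le qpoch_self_Suc)
  have "qpoch (q powi (- int n)) q (Suc l) * q ^ Suc l * q ^ (n choose 2) * qpoch q q (n - Suc l)
          = - (qpoch (q powi (- int n)) q l * q ^ l * q ^ (n choose 2) * (qpoch q q r * (1 - q ^ Suc r))) / q ^ r"
    unfolding qpoch_Suc[of _ _ l] e using assms(1)
    by (simp only: n power_Suc add_diff_cancel_left') (simp add: field_simps)
  also have "\<dots> = (-1) ^ Suc l * q ^ ((n - Suc l) choose 2) * qpoch q q n"
    unfolding IH using assms(1) by (simp add: n)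
  finally show ?case .
qed simp

lemma little_q_Laguerre_eq:
  fixes q :: "'a::real_normed_field"
  assumes q: "norm q < 1" and "q \<noteq> 0"
  shows "little_q_Laguerre n x a q =
           (\<Sum>l\<le>n. qbinom q n l * ((-1) ^ l * q ^ ((n - l) choose 2)) / qpoch (a * q) q l * x ^ l)
             / q ^ (n choose 2)"
proof -
  let ?f = "\<lambda>l. qpoch (q powi (- int n)) q l / (qpoch q q l * qpoch (a * q) q l) * (q * x) ^ l"
  have "little_q_Laguerre n x a q = (\<Sum>l. ?f l)"
    by (simp add: little_q_Laguerre_def basic_hypergeom_def qpochs_def qpoch_def[of 0])
  also have "\<dots> = (\<Sum>l\<le>n. ?f l)"
    by (intro suminf_finite) (auto simp: qpoch_neg_power_eq_0 assms)
  also have "\<dots> = (\<Sum>l\<le>n. qbinom q n l * ((-1) ^ l * q ^ ((n - l) choose 2)) / qpoch (a * q) q l * x ^ l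
                     / q ^ (n choose 2))"
  proof (rule sum.cong)
    fix l assume "l \<in> {..n}"
    hence l: "l \<le> n" by simp
    have nz: "qpoch q q (n - l) \<noteq> 0" by (rule qpoch_nonzero'[OF q q])
    have *: "qpoch (q powi (- int n)) q l * q ^ l
        = (-1) ^ l * q ^ ((n - l) choose 2) * qpoch q q n / (q ^ (n choose 2) * qpoch q q (n - l))"
      using qpoch_neg_power[OF assms(2) l] nz assms(2) by (simp add: eq_divide_eq mult_ac)
    have "?f l = (qpoch (q powi (- int n)) q l * q ^ l) / (qpoch q q l * qpoch (a * q) q l) * x ^ l"
      by (simp add: power_mult_distrib mult_ac)
    thus "?f l = qbinom q n l * ((-1) ^ l * q ^ ((n - l) choose 2)) / qpoch (a * q) q l * x ^ l
                     / q ^ (n choose 2)"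
      unfolding * using l by (simp add: qbinom_def mult_ac)
  qed simp
  finally show ?thesis by (simp add: sum_divide_distrib)
qed

text \<open>
  Inserting the monomials of the polynomial, the sum over \<open>k\<close> becomes Euler's series at
  \<open>aq q^(l+i)\<close>, with value \<open>(aq;q)_(l+i) / (aq;q)_\<infinity>\<close>. The remaining finite sum over \<open>l\<close> is the
  terminating Chu--Vandermonde sum with \<open>b = aq q^i\<close> and \<open>c = aq\<close>. For \<open>i < n\<close> the product
  contains the factor \<open>j = i\<close> and vanishes: this is orthogonality.
\<close>

lemma little_q_Laguerre_moment:
  fixes q a :: "'a::{real_normed_field,banach}"
  assumes q: "norm q < 1" "q \<noteq> 0" and a: "norm (a * q) < 1"
  shows "(\<lambda>k. (a * q) ^ k / qpoch q q k * little_q_Laguerre n (q ^ k) a q * (q ^ k) ^ i) sums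
           ((\<Prod>j<n. a * q * q ^ i - a * q * q ^ j) * qpoch (a * q) q i
              / (qpoch (a * q) q n * qpoch_inf (a * q) q))"
proof -
  define c where "c = a * q"
  note nz = qpoch_nonzero'[OF q(1) a, folded c_def]
  define d where "d = (\<lambda>l. qbinom q n l * ((-1) ^ l * q ^ ((n - l) choose 2)) / qpoch c q l)"
  have pow: "(\<lambda>k. (c * q ^ (l + i)) ^ k / qpoch q q k) sums (qpoch c q (i + l) / qpoch_inf c q)" for l
  proof -
    have "norm (c * q ^ (l + i)) < 1"
      by (rule mult_power_norm_less_1[OF q(1) a[folded c_def]])
    from euler_sums[OF q(1) this] show ?thesis
      using qpoch_inf_split[OF q(1), of c "l + i"] nz[of "l + i"] by (simp add: add_ac)
  qed
  have "(\<lambda>k. (\<Sum>l\<le>n. d l * ((c * q ^ (l + i)) ^ k / qpoch q q k)) / q ^ (n choose 2)) sums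
          ((\<Sum>l\<le>n. d l * (qpoch c q (i + l) / qpoch_inf c q)) / q ^ (n choose 2))"
    by (intro sums_divide sums_sum sums_mult pow)
  also have "(\<lambda>k. (\<Sum>l\<le>n. d l * ((c * q ^ (l + i)) ^ k / qpoch q q k)) / q ^ (n choose 2)) =
      (\<lambda>k. c ^ k / qpoch q q k * little_q_Laguerre n (q ^ k) a q * (q ^ k) ^ i)"
    by (rule ext, simp add: little_q_Laguerre_eq q sum_distrib_left sum_distrib_right sum_divide_distrib
        d_def c_def, rule sum.cong)
       (simp_all add: power_mult_distrib power_add mult_ac flip: power_mult)
  also have "(\<Sum>l\<le>n. d l * (qpoch c q (i + l) / qpoch_inf c q)) =
      (\<Sum>l\<le>n. qpoch c q i / (qpoch c q n * qpoch_inf c q) * (qbinom q n l *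
         ((-1) ^ l * q ^ ((n - l) choose 2) * qpoch (c * q ^ i) q l * qpoch (c * q ^ l) q (n - l))))"
  proof (rule sum.cong)
    fix l assume "l \<in> {..n}"
    hence "qpoch c q n = qpoch c q l * qpoch (c * q ^ l) q (n - l)"
      using qpoch_add[of c q l "n - l"] by simp
    with nz[of n] show "d l * (qpoch c q (i + l) / qpoch_inf c q) =
      qpoch c q i / (qpoch c q n * qpoch_inf c q) * (qbinom q n l *
         ((-1) ^ l * q ^ ((n - l) choose 2) * qpoch (c * q ^ i) q l * qpoch (c * q ^ l) q (n - l)))"
      by (simp add: d_def qpoch_add)
  qed simp
  also have "\<dots> = q ^ (n choose 2) * ((\<Prod>j<n. c * q ^ i - c * q ^ j) * qpoch c q i
              / (qpoch c q n * qpoch_inf c q))"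
    unfolding sum_distrib_left[symmetric] chu_vandermonde_terminating[OF q(1)] by simp
  finally show ?thesis using q(2) by (simp add: c_def)
qed

text \<open>
  The product in the moment of order \<open>i = n + m\<close>. Its factor \<open>(q;q)_(n+m)\<close> cancels a denominator of
  the coefficient of \<open>x^i\<close> in \<open>F\<close>, leaving \<open>(q;q)_m\<close>.
\<close>

lemma prod_power_diff:
  fixes q :: "'a::real_normed_field"
  shows "(\<Prod>j<n. q ^ (n + m) - q ^ j) * qpoch q q m = (-1) ^ n * q ^ (n choose 2) * qpoch q q (n + m)"
proof (induction n)
  case (Suc n)
  have "(\<Prod>j<Suc n. q ^ (Suc n + m) - q ^ j) = (q ^ (Suc n + m) - 1) * (\<Prod>j<n. q * (q ^ (n + m) - q ^ j))"
    by (subst prod.lessThan_Suc_shift) (simp add: algebra_simps)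
  also have "\<dots> = (q ^ (Suc n + m) - 1) * q ^ n * (\<Prod>j<n. q ^ (n + m) - q ^ j)"
    by (subst prod.distrib) simp
  finally have "(\<Prod>j<Suc n. q ^ (Suc n + m) - q ^ j) * qpoch q q m =
      (q ^ (Suc n + m) - 1) * q ^ n * ((-1) ^ n * q ^ (n choose 2) * qpoch q q (n + m))"
    by (simp add: mult.assoc Suc.IH)
  thus ?case
    by (simp add: qpoch_Suc choose_two_Suc power_add algebra_simps)
qed (simp add: binomial_eq_0)

section \<open>Interchange of summation and conclusion\<close>

text \<open>
  The double series is dominated by the product of two absolutely convergent series.
\<close>

lemma sums_swap_bounded_kernel:
  fixes a b :: "nat \<Rightarrow> 'a::{real_normed_field,banach}"
  assumes a: "summable (\<lambda>k. norm (a k))" and b: "summable (\<lambda>i. norm (b i))"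
    and w: "\<And>k i. norm (w k i) \<le> 1"
  shows "(\<lambda>k. a k * (\<Sum>i. b i * w k i)) sums (\<Sum>i. b i * (\<Sum>k. a k * w k i))"
proof -
  let ?f = "\<lambda>(k, i). a k * b i * w k i"
  have sa: "summable (\<lambda>k. norm (a k * w k i))" for i
    by (rule summable_comparison_test'[OF a, of 0]) (simp add: norm_mult mult_left_le w)
  have sb: "summable (\<lambda>i. norm (b i * w k i))" for k
    by (rule summable_comparison_test'[OF b, of 0]) (simp add: norm_mult mult_left_le w)
  have "(\<lambda>p. norm (case p of (k, i) \<Rightarrow> a k * b i)) summable_on (UNIV \<times> UNIV)"
    unfolding Infinite_Sum.abs_summable_on_Sigma_iff
  proof (intro conjI ballI)
    fix k :: nat
    have "summable (\<lambda>i. norm (norm (a k * b i)))" using summable_mult[OF b, of "norm (a k)"] by (simp add: norm_mult)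
    thus "(\<lambda>i. norm (case (k, i) of (k, i) \<Rightarrow> a k * b i)) summable_on UNIV"
      by (intro norm_summable_imp_summable_on) simp
  next
    have "summable (\<lambda>k. norm (norm (infsum (\<lambda>i. norm (a k * b i)) UNIV)))"
      using summable_mult2[OF a, of "\<bar>infsum (\<lambda>i. norm (b i)) UNIV\<bar>"]
      by (simp add: norm_mult infsum_cmult_right' abs_mult)
    thus "(\<lambda>k. norm (\<Sum>\<^sub>\<infinity>i. norm (case (k, i) of (k, i) \<Rightarrow> a k * b i))) summable_on UNIV"
      by (intro norm_summable_imp_summable_on) simp
  qed
  hence "(\<lambda>p. norm (?f p)) summable_on (UNIV \<times> UNIV)"
  proof (rule Infinite_Sum.abs_summable_on_comparison_test)
    fix p :: "nat \<times> nat"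
    show "norm (?f p) \<le> norm (case p of (k, i) \<Rightarrow> a k * b i)"
      using w[of "fst p" "snd p"] by (cases p) (simp add: norm_mult mult_left_le)
  qed
  hence "?f summable_on (UNIV \<times> UNIV)"
    by (rule abs_summable_summable)
  then obtain S where S: "(?f has_sum S) (UNIV \<times> UNIV)"
    by (auto simp: summable_on_def)
  have "((\<lambda>i. a k * (b i * w k i)) has_sum (a k * (\<Sum>i. b i * w k i))) UNIV" for k
    by (intro has_sum_cmult_right norm_summable_imp_has_sum sb summable_sums summable_norm_cancel[OF sb])
  hence "((\<lambda>k. a k * (\<Sum>i. b i * w k i)) has_sum S) UNIV"
    by (intro has_sum_SigmaD[OF S]) (simp add: mult_ac)
  moreover have "((\<lambda>i. b i * (\<Sum>k. a k * w k i)) has_sum S) UNIV"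
  proof (rule has_sum_SigmaD[OF has_sum_swap[THEN iffD1, OF S]])
    fix i :: nat
    have "((\<lambda>k. b i * (a k * w k i)) has_sum (b i * (\<Sum>k. a k * w k i))) UNIV"
      by (intro has_sum_cmult_right norm_summable_imp_has_sum sa summable_sums summable_norm_cancel[OF sa])
    thus "((\<lambda>k. case (i, k) of (x, y) \<Rightarrow> case (y, x) of (k, i) \<Rightarrow> a k * b i * w k i)
            has_sum (b i * (\<Sum>k. a k * w k i))) UNIV"
      by (simp add: mult_ac)
  qed
  hence "S = (\<Sum>i. b i * (\<Sum>k. a k * w k i))"
    by (intro sums_unique has_sum_imp_sums)
  ultimately show ?thesis
    by (auto intro: has_sum_imp_sums)
qed

lemma summable_norm_little_q_Laguerre:
  fixes q a :: "'a::real_normed_field"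
  assumes q: "norm q < 1" "q \<noteq> 0" and a: "norm (a * q) < 1"
  shows "summable (\<lambda>k. norm ((a * q) ^ k / qpoch q q k * little_q_Laguerre n (q ^ k) a q))"
proof -
  define d where "d = (\<lambda>l. qbinom q n l * ((-1) ^ l * q ^ ((n - l) choose 2)) / qpoch (a * q) q l
                             / q ^ (n choose 2))"
  have "summable (\<lambda>k. \<Sum>l\<le>n. norm (d l) * norm ((a * q * q ^ l) ^ k / qpoch q q k))"
    by (intro summable_sum summable_mult summable_norm_powser_qpoch mult_power_norm_less_1 q a)
  moreover have eq: "(a * q) ^ k / qpoch q q k * little_q_Laguerre n (q ^ k) a q =
      (\<Sum>l\<le>n. d l * ((a * q * q ^ l) ^ k / qpoch q q k))" for k
    by (simp add: little_q_Laguerre_eq q sum_distrib_left sum_divide_distrib d_def, rule sum.cong)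
       (simp_all add: power_mult_distrib mult_ac flip: power_mult)
  ultimately show ?thesis
  proof (elim summable_comparison_test'[where N = 0])
    fix k :: nat
    have "norm (\<Sum>l\<le>n. d l * ((a * q * q ^ l) ^ k / qpoch q q k))
            \<le> (\<Sum>l\<le>n. norm (d l * ((a * q * q ^ l) ^ k / qpoch q q k)))"
      by (rule norm_sum)
    thus "norm (norm ((a * q) ^ k / qpoch q q k * little_q_Laguerre n (q ^ k) a q))
            \<le> (\<Sum>l\<le>n. norm (d l) * norm ((a * q * q ^ l) ^ k / qpoch q q k))"
      unfolding eq by (simp only: norm_mult real_norm_def abs_norm_cancel)
  qed
qed

text \<open>
  The functional \<open>L\<close> is applied to \<open>F p_n\<close> term by term. The moments with \<open>i < n\<close> vanish, and the
  others, shifted by \<open>n\<close>, form a series to which \<open>confluent_transformation\<close> applies once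
  more. The argument needs absolute values below \<open>1\<close> and nonzero denominators, and so works in any
  Banach field.
\<close>

theorem little_q_Laguerre_generating_sum:
  fixes q A B t :: "'a::{real_normed_field,banach}"
  assumes q: "norm q < 1" "q \<noteq> 0" and B: "B \<noteq> 0" "norm (q * B) < 1"
    and A: "\<And>j. q * A * q ^ j \<noteq> 1" and t: "norm t < 1"
  shows "(\<lambda>k. (q * B) ^ k / qpoch_inf (t * q ^ k) q
            * basic_hypergeom [] [q * A] q (t * A * q ^ (k + 1))
            * (little_q_Laguerre n (q ^ k) B q / qpoch q q k))
         sums
         (q ^ (n choose 2) * (- (q * B) * t) ^ n / (qpochs_inf [t, q * B] q * qpoch (q * A) q n)
            * basic_hypergeom [A / B] [A * q ^ (n + 1)] q (t * B * q ^ (n + 1)))"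
proof -
  define a where "a = (\<lambda>k. (B * q) ^ k / qpoch q q k * little_q_Laguerre n (q ^ k) B q)"
  define b where "b = (\<lambda>i. t ^ i / (qpoch (q * A) q i * qpoch q q i))"
  define c where "c = B * q"
  have c: "norm c < 1" using B by (simp add: c_def mult.commute)
  \<comment> \<open>\<open>a\<close> holds the weights of \<open>L\<close> times \<open>p_n\<close>, and \<open>b\<close> the coefficients of \<open>F\<close>.\<close>
  have "(\<lambda>k. a k * (\<Sum>i. b i * (q ^ k) ^ i)) sums (\<Sum>i. b i * (\<Sum>k. a k * (q ^ k) ^ i))"
  proof (rule sums_swap_bounded_kernel)
    show "summable (\<lambda>k. norm (a k))"
      unfolding a_def using B by (intro summable_norm_little_q_Laguerre q) (simp add: mult.commute)
    show "summable (\<lambda>i. norm (b i))"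
      unfolding b_def using summable_norm_qpoch_quotient[OF q(1) t, of 0] by (simp add: qpoch_def[of 0])
    show "norm ((q ^ k) ^ i) \<le> 1" for k i
      using q by (simp add: norm_power power_le_one)
  qed
  also have "(\<lambda>k. a k * (\<Sum>i. b i * (q ^ k) ^ i)) =
      (\<lambda>k. (q * B) ^ k / qpoch_inf (t * q ^ k) q
            * basic_hypergeom [] [q * A] q (t * A * q ^ (k + 1))
            * (little_q_Laguerre n (q ^ k) B q / qpoch q q k))"
  proof
    fix k
    have "norm (t * q ^ k) < 1" by (rule mult_power_norm_less_1[OF q(1) t])
    from confluent_transformation[OF q(1) this A, of 0]
    \<comment> \<open>The case \<open>b = 0\<close>, where the factors \<open>(0;q)_i\<close> are \<open>1\<close>, is the power series of \<open>F\<close> at \<open>q^k\<close>.\<close>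
    have "(\<Sum>i. b i * (q ^ k) ^ i) = 1 / qpoch_inf (t * q ^ k) q *
            basic_hypergeom [] [q * A] q (t * q ^ k * (q * A))"
      unfolding basic_hypergeom_0_1_eq
      by (simp add: sums_iff b_def power_mult_distrib qpoch_def[of 0])
    thus "a k * (\<Sum>i. b i * (q ^ k) ^ i) = (q * B) ^ k / qpoch_inf (t * q ^ k) q
            * basic_hypergeom [] [q * A] q (t * A * q ^ (k + 1))
            * (little_q_Laguerre n (q ^ k) B q / qpoch q q k)"
      by (simp add: a_def mult_ac)
  qed
  also have "(\<Sum>i. b i * (\<Sum>k. a k * (q ^ k) ^ i)) =
     q ^ (n choose 2) * (- (q * B) * t) ^ n / (qpochs_inf [t, q * B] q * qpoch (q * A) q n)
            * basic_hypergeom [A / B] [A * q ^ (n + 1)] q (t * B * q ^ (n + 1))"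
    (is "_ = ?rhs")
  proof (rule sums_unique[symmetric])
    define L where "L = (\<lambda>i. (\<Prod>j<n. c * q ^ i - c * q ^ j) * qpoch c q i / (qpoch c q n * qpoch_inf c q))"
    have L: "(\<Sum>k. a k * (q ^ k) ^ i) = L i" for i
      using little_q_Laguerre_moment[OF q c[unfolded c_def], of n i]
      by (simp add: sums_iff a_def L_def c_def)
    have L_less: "L i = 0" if "i < n" for i
      using that by (auto simp: L_def)
    define K where "K = (- c) ^ n * t ^ n * q ^ (n choose 2) / (qpoch_inf c q * qpoch (q * A) q n)"
    have nzA: "qpoch (q * A) q m \<noteq> 0" for m using A by (rule qpoch_nonzero)
    have shifted: "b (m + n) * L (m + n) =
        K * (qpoch (c * q ^ n) q m * t ^ m / (qpoch (q * A * q ^ n) q m * qpoch q q m))" for m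
    proof -
      note nz = qpoch_nonzero'[OF q(1) q(1)] qpoch_nonzero'[OF q(1) c]
      have "(\<Prod>j<n. c * q ^ (n + m) - c * q ^ j) = c ^ n * (\<Prod>j<n. q ^ (n + m) - q ^ j)"
        by (simp add: prod.distrib flip: right_diff_distrib)
      also have "\<dots> = (- c) ^ n * q ^ (n choose 2) * qpoch q q (n + m) / qpoch q q m"
        using prod_power_diff[where n = n and q = q and m = m] nz(1)[of m]
        by (simp add: eq_divide_eq power_minus[of c n] mult.assoc)
      finally have p: "(\<Prod>j<n. c * q ^ (n + m) - c * q ^ j) =
          (- c) ^ n * q ^ (n choose 2) * qpoch q q (n + m) / qpoch q q m" .
      show ?thesis
        unfolding add.commute[of m n] L_def p
        using nz(1)[of "n + m"] nz(2)[of n]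
        by (simp only: b_def K_def qpoch_add[of c] qpoch_add[of "q * A" q n m] power_add)
           (simp add: mult_ac)
    qed
    have C: "q * A * q ^ n * q ^ j \<noteq> 1" for j
      using A[of "n + j"] by (simp add: power_add mult_ac)
    have bc: "c * q ^ n \<noteq> 0" using B q by (simp add: c_def)
    have "(\<lambda>m. b (m + n) * L (m + n)) sums (K * (1 / qpoch_inf t q *
            basic_hypergeom [q * A * q ^ n / (c * q ^ n)] [q * A * q ^ n] q (t * (c * q ^ n))))"
      unfolding shifted basic_hypergeom_1_1_eq[OF bc]
      by (intro sums_mult confluent_transformation q t C)
    also have "K * (1 / qpoch_inf t q *
            basic_hypergeom [q * A * q ^ n / (c * q ^ n)] [q * A * q ^ n] q (t * (c * q ^ n))) = ?rhs"
    proof -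
      have "(- c) ^ n * t ^ n = (- (q * B) * t) ^ n"
        by (simp only: power_mult_distrib[symmetric] c_def mult.commute[of B])
      thus ?thesis
        using q by (simp add: K_def c_def qpochs_inf_def mult_ac)
    qed
    finally show "(\<lambda>i. b i * (\<Sum>k. a k * (q ^ k) ^ i)) sums ?rhs"
      unfolding L by (subst (asm) sums_zero_iff_shift) (auto simp: L_less)
  qed
  finally show ?thesis .
qed

theorem corollary29:
  fixes q \<alpha> \<beta> :: real and t :: complex and n :: nat
  assumes "0 < q" and "q < 1"
    and "\<alpha> \<in> {0<..<inverse q}" and "\<beta> \<in> {0<..<inverse q}"
    and "norm t < min ((1 - \<beta>\<^sup>2) * (1 + sqrt q * \<bar>\<beta>\<bar>)) 1"
  shows "(\<lambda>k. of_real (q * \<beta>) ^ k / qpoch_inf (t * of_real q ^ k) (of_real q)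
            * basic_hypergeom [] [of_real (q * \<alpha>)] (of_real q)
                (t * of_real \<alpha> * of_real q ^ (k + 1))
            * (little_q_Laguerre n (of_real q ^ k) (of_real \<beta>) (of_real q)
                / qpoch (of_real q) (of_real q) k))
         sums
         (of_real q ^ (n choose 2) * (- of_real (q * \<beta>) * t) ^ n
            / (qpochs_inf [t, of_real (q * \<beta>)] (of_real q)
               * qpoch (of_real (q * \<alpha>)) (of_real q) n)
            * basic_hypergeom [of_real (\<alpha> / \<beta>)] [of_real (\<alpha> * q ^ (n + 1))] (of_real q)
                (t * of_real \<beta> * of_real q ^ (n + 1)))"
proof -
  have less: "norm (complex_of_real q * of_real x) < 1" if "x \<in> {0<..<inverse q}" for x
    using that assms(1) by (simp add: norm_mult field_simps)
  have q: "norm (complex_of_real q) < 1" "complex_of_real q \<noteq> 0"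
    using assms by auto
  have "complex_of_real q * of_real \<alpha> * of_real q ^ j \<noteq> 1" for j
    using mult_power_norm_less_1[OF q(1) less[OF assms(3)], of j] by (metis norm_one less_irrefl)
  from little_q_Laguerre_generating_sum[OF q _ less[OF assms(4)] this, of t n] show ?thesis
    using assms by simp
qed

end
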